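(* A finite simple graph $G$ is a cograph if and only if every acyclic coloring of $G$ is also a star coloring of $G$.
   Context: A proper coloring of a graph $G=(V,E)$ is a map $\phi:V\to\mathbb{N}^+$ with $\phi(a)\neq\phi(b)$ whenever $ab\in E$. An acyclic coloring is a proper coloring such that the subgraph induced by the union of any two color classes is a disjoint union of trees (equivalently, every cycle of $G$ uses at least three colors). A star coloring is a proper coloring such that the subgraph induced by the union of any two color classes is a disjoint union of stars (equivalently, every path on four vertices in $G$ uses at least three colors). Cographs are defined recursively: a single-vertex graph is a cograph; the disjoint union $G_1\cup\cdots\cup G_k$ of cographs is a cograph; the join $G_1\oplus\cdots\oplus G_k$ of cographs (disjoint union plus all edges between vertices of different $G_i$) is a cograph. Equivalently, cographs are exactly the graphs with no induced path on four vertices. *)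

theory Defs
  imports "Graph_Theory.Digraph_Component"
begin

text \<open>
  A finite simple graph is a \<^locale>\<open>pair_graph\<close>: the edge \<open>ab\<close> is represented by the two arcs
  \<open>(a, b)\<close> and \<open>(b, a)\<close>.
\<close>

definition pair_induce :: "'a pair_pre_digraph \<Rightarrow> 'a set \<Rightarrow> 'a pair_pre_digraph" where
  "pair_induce G S = \<lparr>pverts = pverts G \<inter> S, parcs = {(u, v) \<in> parcs G. u \<in> S \<and> v \<in> S}\<rparr>"

definition vertex_disjoint :: "'a pair_pre_digraph set \<Rightarrow> bool" where
  "vertex_disjoint Hs \<longleftrightarrow> pairwise (\<lambda>H K. pverts H \<inter> pverts K = {}) Hs"

definition graph_union :: "'a pair_pre_digraph set \<Rightarrow> 'a pair_pre_digraph" where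
  "graph_union Hs = \<lparr>pverts = (\<Union>H\<in>Hs. pverts H), parcs = (\<Union>H\<in>Hs. parcs H)\<rparr>"

definition graph_join :: "'a pair_pre_digraph set \<Rightarrow> 'a pair_pre_digraph" where
  "graph_join Hs = \<lparr>pverts = (\<Union>H\<in>Hs. pverts H),
     parcs = (\<Union>H\<in>Hs. parcs H) \<union>
       {(u, v). \<exists>H\<in>Hs. \<exists>K\<in>Hs. H \<noteq> K \<and> u \<in> pverts H \<and> v \<in> pverts K}\<rparr>"

text \<open>The operands \<open>G\<^sub>1, \<dots>, G\<^sub>k\<close> (\<open>k \<ge> 1\<close>) form a nonempty finite set of graphs; nothing is lost by
  using a set, because vertex-disjoint nonempty graphs are distinct.\<close>

inductive cograph :: "'a pair_pre_digraph \<Rightarrow> bool" where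
  single: "cograph \<lparr>pverts = {v}, parcs = {}\<rparr>"
| disjoint_union: "finite Hs \<Longrightarrow> Hs \<noteq> {} \<Longrightarrow> vertex_disjoint Hs \<Longrightarrow> (\<And>H. H \<in> Hs \<Longrightarrow> cograph H) \<Longrightarrow>
    cograph (graph_union Hs)"
| join: "finite Hs \<Longrightarrow> Hs \<noteq> {} \<Longrightarrow> vertex_disjoint Hs \<Longrightarrow> (\<And>H. H \<in> Hs \<Longrightarrow> cograph H) \<Longrightarrow>
    cograph (graph_join Hs)"

text \<open>The constants \<^const>\<open>forest\<close> and \<^const>\<open>tree\<close> are of no use for undirected graphs, since
  \<^const>\<open>pre_digraph.cycle\<close> admits the closed walk \<open>a, b, a\<close> along a single edge. A cycle of an
  undirected graph is a \<^const>\<open>pre_digraph.cycle\<close> of length at least 3.\<close>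

definition undirected_tree :: "'a pair_pre_digraph \<Rightarrow> bool" where
  "undirected_tree T \<longleftrightarrow> pair_graph T \<and> Digraph_Component.connected (with_proj T) \<and>
     \<not> (\<exists>p. pre_digraph.cycle (with_proj T) p \<and> 3 \<le> length p)"

text \<open>A star is \<open>K\<^sub>1\<^sub>,\<^sub>m\<close> with \<open>m \<ge> 0\<close>, so a single vertex is a star.\<close>

definition star :: "'a pair_pre_digraph \<Rightarrow> bool" where
  "star T \<longleftrightarrow> finite (pverts T) \<and> (\<exists>c\<in>pverts T.
     parcs T = {c} \<times> (pverts T - {c}) \<union> (pverts T - {c}) \<times> {c})"

text \<open>The family may be empty: the graph without vertices is a disjoint union of no graphs.
  It arises below from two unused colors.\<close>

definition disjoint_union_of :: "('a pair_pre_digraph \<Rightarrow> bool) \<Rightarrow> 'a pair_pre_digraph \<Rightarrow> bool" where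
  "disjoint_union_of P G \<longleftrightarrow>
     (\<exists>Hs. finite Hs \<and> vertex_disjoint Hs \<and> (\<forall>H\<in>Hs. P H) \<and> G = graph_union Hs)"

text \<open>Colors are the positive natural numbers; only the values on the vertices matter.\<close>

definition proper_coloring :: "'a pair_pre_digraph \<Rightarrow> ('a \<Rightarrow> nat) \<Rightarrow> bool" where
  "proper_coloring G \<phi> \<longleftrightarrow>
     (\<forall>v\<in>pverts G. 0 < \<phi> v) \<and> (\<forall>a b. (a, b) \<in> parcs G \<longrightarrow> \<phi> a \<noteq> \<phi> b)"

definition color_class :: "'a pair_pre_digraph \<Rightarrow> ('a \<Rightarrow> nat) \<Rightarrow> nat \<Rightarrow> 'a set" where
  "color_class G \<phi> i = {v \<in> pverts G. \<phi> v = i}"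

definition acyclic_coloring :: "'a pair_pre_digraph \<Rightarrow> ('a \<Rightarrow> nat) \<Rightarrow> bool" where
  "acyclic_coloring G \<phi> \<longleftrightarrow> proper_coloring G \<phi> \<and>
     (\<forall>i>0. \<forall>j>0. i \<noteq> j \<longrightarrow>
        disjoint_union_of undirected_tree (pair_induce G (color_class G \<phi> i \<union> color_class G \<phi> j)))"

definition star_coloring :: "'a pair_pre_digraph \<Rightarrow> ('a \<Rightarrow> nat) \<Rightarrow> bool" where
  "star_coloring G \<phi> \<longleftrightarrow> proper_coloring G \<phi> \<and>
     (\<forall>i>0. \<forall>j>0. i \<noteq> j \<longrightarrow>
        disjoint_union_of star (pair_induce G (color_class G \<phi> i \<union> color_class G \<phi> j)))"

end

theory Submission
  imports Defs
begin

text \<open>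
  Both sides are equivalent to the absence of an induced path on four vertices. If two colours of an
  acyclic colouring induce a graph that is not a disjoint union of stars, that graph contains a path
  \<open>a, b, c, d\<close>; the colours exclude the chords \<open>ac\<close> and \<open>bd\<close>, and acyclicity excludes \<open>ad\<close>, so the
  path is induced. Conversely, given an induced path \<open>a, b, c, d\<close>, colour \<open>a, c\<close> with one colour,
  \<open>b, d\<close> with another and every remaining vertex with its own colour: this colouring is acyclic but
  not a star colouring. That graphs without induced four-vertex paths are cographs is Seinsche's
  theorem: such a graph on at least two vertices, or its complement, is disconnected.
\<close>

section \<open>Induced paths on four vertices\<close>

text \<open>A vertex set and a relation instead of a graph record, so that complementing is just
  \<open>- E\<close>. That relation contains the diagonal, which \<open>distinct\<close> makes
  harmless.\<close>

definition P4_free :: "'a set \<Rightarrow> 'a rel \<Rightarrow> bool" where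
  "P4_free V E \<longleftrightarrow> \<not> (\<exists>a\<in>V. \<exists>b\<in>V. \<exists>c\<in>V. \<exists>d\<in>V. distinct [a, b, c, d] \<and>
     (a, b) \<in> E \<and> (b, c) \<in> E \<and> (c, d) \<in> E \<and> (a, c) \<notin> E \<and> (a, d) \<notin> E \<and> (b, d) \<notin> E)"

lemma P4_freeD:
  assumes "P4_free V E" "a \<in> V" "b \<in> V" "c \<in> V" "d \<in> V" "distinct [a, b, c, d]"
    "(a, b) \<in> E" "(b, c) \<in> E" "(c, d) \<in> E" "(a, c) \<notin> E" "(a, d) \<notin> E" "(b, d) \<notin> E"
  shows False
  using assms unfolding P4_free_def by blast

lemma P4_free_subset: "P4_free V E \<Longrightarrow> W \<subseteq> V \<Longrightarrow> P4_free W E"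
  unfolding P4_free_def by blast

text \<open>The complement of the path \<open>a, b, c, d\<close> is the path \<open>b, d, a, c\<close>.\<close>

lemma P4_free_Compl:
  assumes "P4_free V E" "sym E"
  shows "P4_free V (- E)"
  unfolding P4_free_def
proof safe
  fix a b c d
  assume "a \<in> V" "b \<in> V" "c \<in> V" "d \<in> V" "distinct [a, b, c, d]"
    "(a, b) \<notin> E" "(b, c) \<notin> E" "(c, d) \<notin> E" "(a, c) \<in> E" "(a, d) \<in> E" "(b, d) \<in> E"
  with assms show False
    using P4_freeD[of V E b d a c] by (auto dest: symD)
qed

text \<open>For symmetric \<open>E\<close> this is disconnectedness on \<open>V\<close>, phrased as
  a cut instead of by reachability so that it applies directly to \<open>- E\<close>.\<close>

definition separable :: "'a set \<Rightarrow> 'a rel \<Rightarrow> bool" where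
  "separable V E \<longleftrightarrow> (\<exists>A B. A \<noteq> {} \<and> B \<noteq> {} \<and> A \<inter> B = {} \<and> A \<union> B = V \<and>
     (\<forall>x\<in>A. \<forall>y\<in>B. (x, y) \<notin> E))"

lemma separableI:
  assumes "A \<subseteq> V" "A \<noteq> {}" "V - A \<noteq> {}" "\<And>x y. x \<in> A \<Longrightarrow> y \<in> V - A \<Longrightarrow> (x, y) \<notin> E"
  shows "separable V E"
  unfolding separable_def using assms by (intro exI[of _ A] exI[of _ "V - A"]) auto

text \<open>If \<open>insert v V\<close> with \<open>E\<close> is connected, then \<open>v\<close>
  must be adjacent to every vertex on both sides of the cut of \<open>V\<close>, since otherwise an
  induced path appears. But then \<open>v\<close> is isolated in the complement.\<close>

lemma separable_insert:
  assumes free: "P4_free (insert v V) E" and "sym E" and "v \<notin> V" and "separable V E"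
  shows "separable (insert v V) E \<or> separable (insert v V) (- E)"
proof (rule ccontr)
  assume neg: "\<not> ?thesis"
  obtain A B where AB: "A \<noteq> {}" "B \<noteq> {}" "A \<inter> B = {}" "A \<union> B = V"
    and no: "\<And>x y. x \<in> A \<Longrightarrow> y \<in> B \<Longrightarrow> (x, y) \<notin> E"
    using \<open>separable V E\<close> unfolding separable_def by blast
  have sym: "(x, y) \<in> E \<longleftrightarrow> (y, x) \<in> E" for x y
    using \<open>sym E\<close> by (auto dest: symD)
  \<comment> \<open>Stated for an arbitrary cut, so that it serves for both \<open>(A, B)\<close>
    and \<open>(B, A)\<close>.\<close>
  have adjacent: "\<forall>x\<in>C. (v, x) \<in> E"
    if CD: "C \<noteq> {}" "D \<noteq> {}" "C \<inter> D = {}" "C \<union> D = V"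
      and noCD: "\<And>x y. x \<in> C \<Longrightarrow> y \<in> D \<Longrightarrow> (x, y) \<notin> E" for C D
  proof (rule ccontr)
    define X where "X = {x \<in> C. (v, x) \<notin> E}"
    assume "\<not> (\<forall>x\<in>C. (v, x) \<in> E)"
    then have X: "X \<noteq> {}" "X \<subseteq> C" unfolding X_def by auto
    \<comment> \<open>Without such a \<open>w\<close>, the side \<open>D\<close> would be cut off
      from everything else.\<close>
    obtain w where w: "w \<in> D" "(v, w) \<in> E"
      using neg separableI[of D "insert v V" E] CD noCD \<open>v \<notin> V\<close> sym by blast
    \<comment> \<open>An edge has to leave the set \<open>X\<close> of non-neighbours of
      \<open>v\<close> in \<open>C\<close>. Its end \<open>z\<close> is neither \<open>v\<close> nor
      in \<open>D\<close>, so it is a neighbour of \<open>v\<close> in \<open>C\<close>, and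
      \<open>w, v, z, y\<close> is an induced path.\<close>
    obtain y z where yz: "y \<in> X" "z \<in> insert v V - X" "(y, z) \<in> E"
      using neg separableI[of X "insert v V" E] X CD \<open>v \<notin> V\<close> by blast
    have "z \<in> C" "(v, z) \<in> E" "(v, y) \<notin> E" "y \<in> C"
      using yz noCD CD sym unfolding X_def by auto
    moreover have "(w, v) \<in> E" "(z, y) \<in> E" "(w, z) \<notin> E" "(w, y) \<notin> E"
      using w yz noCD \<open>z \<in> C\<close> \<open>y \<in> C\<close> sym by blast+
    moreover have "v \<notin> C" "v \<notin> D" "w \<notin> C" "z \<in> V" "y \<in> V" "w \<in> V"
      using CD w \<open>z \<in> C\<close> \<open>y \<in> C\<close> \<open>v \<notin> V\<close> by blast+
    ultimately show False
      using P4_freeD[OF free, of w v z y] w(1) by fastforce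
  qed
  have "\<forall>x\<in>A. (v, x) \<in> E" "\<forall>x\<in>B. (v, x) \<in> E"
    using adjacent[of A B] adjacent[of B A] AB no sym by blast+
  then have "separable (insert v V) (- E)"
    using AB \<open>v \<notin> V\<close> by (intro separableI[of "{v}"]) auto
  with neg show False by blast
qed

text \<open>Seinsche's theorem, by adding one vertex at a time. The claim is invariant under
  complementation, so \<open>separable_insert\<close> for \<open>E\<close> and for
  \<open>- E\<close> covers both cases of the induction step.\<close>

lemma P4_free_separable:
  assumes "finite V" "2 \<le> card V" "P4_free V E" "sym E"
  shows "separable V E \<or> separable V (- E)"
  using assms(1-3)
proof (induction V rule: finite_induct)
  case empty
  then show ?case by simp
next
  case (insert v V)
  have symC: "sym (- E)" using \<open>sym E\<close> by (auto simp: sym_def)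
  show ?case
  proof (cases "2 \<le> card V")
    case True
    with insert have "separable V E \<or> separable V (- E)"
      using P4_free_subset by blast
    then show ?thesis
      using separable_insert[OF insert.prems(2) \<open>sym E\<close> insert.hyps(2)]
        separable_insert[OF P4_free_Compl[OF insert.prems(2) \<open>sym E\<close>] symC insert.hyps(2)]
      by auto
  next
    case False
    with insert have "card V = 1" by simp
    then obtain w where w: "V = {w}" by (auto simp: card_1_singleton_iff)
    \<comment> \<open>Two vertices: the cut \<open>{v}\<close>, \<open>{w}\<close> works for
      \<open>E\<close> or for \<open>- E\<close>, according to whether they are adjacent.\<close>
    then show ?thesis
      using separableI[of "{v}" "insert v V" E] separableI[of "{v}" "insert v V" "- E"] insert.hyps(2)
      by auto
  qed
qed

section \<open>Cographs\<close>

lemma pair_graph_iff: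
  "pair_graph G \<longleftrightarrow> finite (pverts G) \<and> parcs G \<subseteq> pverts G \<times> pverts G \<and> sym (parcs G) \<and> irrefl (parcs G)"
  (is "_ \<longleftrightarrow> ?R")
proof
  assume "pair_graph G"
  then interpret pair_graph G .
  show ?R
    using pair_finite_verts in_arcsD1 in_arcsD2 arcs_symmetric
    by (auto simp: irrefl_def intro!: symI dest: no_loops')
next
  assume R: ?R
  then have "finite (parcs G)" by (meson finite_SigmaI finite_subset)
  with R show "pair_graph G"
    by unfold_locales (auto simp: symmetric_def irrefl_def)
qed

lemma pverts_pair_induce [simp]: "pverts (pair_induce G S) = pverts G \<inter> S"
  by (simp add: pair_induce_def)

lemma parcs_pair_induce_iff [simp]:
  "(u, v) \<in> parcs (pair_induce G S) \<longleftrightarrow> (u, v) \<in> parcs G \<and> u \<in> S \<and> v \<in> S"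
  by (simp add: pair_induce_def)

lemma pair_graph_pair_induce: "pair_graph G \<Longrightarrow> pair_graph (pair_induce G S)"
  by (auto simp: pair_graph_iff pair_induce_def sym_def irrefl_def)

lemma pverts_graph_union [simp]: "pverts (graph_union Hs) = (\<Union>H\<in>Hs. pverts H)"
  and parcs_graph_union [simp]: "parcs (graph_union Hs) = (\<Union>H\<in>Hs. parcs H)"
  by (simp_all add: graph_union_def)

lemma vertex_disjointD:
  "vertex_disjoint Hs \<Longrightarrow> H \<in> Hs \<Longrightarrow> K \<in> Hs \<Longrightarrow> x \<in> pverts H \<Longrightarrow> x \<in> pverts K \<Longrightarrow> H = K"
  unfolding vertex_disjoint_def pairwise_def by blast

lemma cograph_parcs_subset: "cograph G \<Longrightarrow> parcs G \<subseteq> pverts G \<times> pverts G"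
proof (induction rule: cograph.induct)
  case (disjoint_union Hs)
  then show ?case by (fastforce simp: graph_union_def)
next
  case (join Hs)
  then show ?case by (fastforce simp: graph_join_def)
qed simp

text \<open>Disjointness makes the operand containing a given vertex unique, which removes the
  existential quantifiers from \<open>graph_join\<close>.\<close>

lemma graph_join_parcs_iff:
  assumes "vertex_disjoint Hs" "\<And>H. H \<in> Hs \<Longrightarrow> parcs H \<subseteq> pverts H \<times> pverts H"
    and "H \<in> Hs" "K \<in> Hs" "u \<in> pverts H" "v \<in> pverts K"
  shows "(u, v) \<in> parcs (graph_join Hs) \<longleftrightarrow> H \<noteq> K \<or> (u, v) \<in> parcs H"
proof -
  have *: "H' = H" if "H' \<in> Hs" "u \<in> pverts H'" for H'
    using vertex_disjointD assms that by metis
  have **: "K' = K" if "K' \<in> Hs" "v \<in> pverts K'" for K'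
    using vertex_disjointD assms that by metis
  have "(u, v) \<in> parcs (graph_join Hs) \<longleftrightarrow> (\<exists>H'\<in>Hs. (u, v) \<in> parcs H') \<or>
      (\<exists>H'\<in>Hs. \<exists>K'\<in>Hs. H' \<noteq> K' \<and> u \<in> pverts H' \<and> v \<in> pverts K')"
    by (simp add: graph_join_def)
  also have "(\<exists>H'\<in>Hs. (u, v) \<in> parcs H') \<longleftrightarrow> (u, v) \<in> parcs H"
    using * assms(2,3) by blast
  also have "(\<exists>H'\<in>Hs. \<exists>K'\<in>Hs. H' \<noteq> K' \<and> u \<in> pverts H' \<and> v \<in> pverts K') \<longleftrightarrow> H \<noteq> K"
    using * ** assms(3-6) by blast
  finally show ?thesis by blast
qed

text \<open>Consecutive vertices of a path share an operand of a union, and non-adjacent vertices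
  share an operand of a join. The path and its complement are both connected, so all four vertices
  lie in one operand, where the induction hypothesis applies.\<close>

lemma P4_free_cograph: "cograph G \<Longrightarrow> P4_free (pverts G) (parcs G)"
proof (induction rule: cograph.induct)
  case (single v)
  then show ?case by (simp add: P4_free_def)
next
  case (disjoint_union Hs)
  have wf: "x \<in> pverts H \<and> y \<in> pverts H" if "H \<in> Hs" "(x, y) \<in> parcs H" for H x y
    using cograph_parcs_subset disjoint_union.hyps(4) that by blast
  show ?case
    unfolding P4_free_def
  proof safe
    fix a b c d
    assume "distinct [a, b, c, d]" "(a, b) \<in> parcs (graph_union Hs)" "(b, c) \<in> parcs (graph_union Hs)"
      "(c, d) \<in> parcs (graph_union Hs)" and non: "(a, c) \<notin> parcs (graph_union Hs)"
      "(a, d) \<notin> parcs (graph_union Hs)" "(b, d) \<notin> parcs (graph_union Hs)"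
    then obtain H K L where *: "H \<in> Hs" "(a, b) \<in> parcs H" "K \<in> Hs" "(b, c) \<in> parcs K"
      "L \<in> Hs" "(c, d) \<in> parcs L" by auto
    then have "H = K" "K = L"
      using vertex_disjointD[OF disjoint_union.hyps(3)] wf by metis+
    with * show False
      using P4_freeD[OF disjoint_union.IH, of H a b c d] wf[of H] non \<open>distinct [a, b, c, d]\<close> by auto
  qed
next
  case (join Hs)
  note arc = graph_join_parcs_iff[OF join.hyps(3) cograph_parcs_subset[OF join.hyps(4)]]
  show ?case
    unfolding P4_free_def
  proof safe
    fix a b c d
    assume "a \<in> pverts (graph_join Hs)" "b \<in> pverts (graph_join Hs)" "c \<in> pverts (graph_join Hs)"
      "d \<in> pverts (graph_join Hs)" and
      arcs: "distinct [a, b, c, d]" "(a, b) \<in> parcs (graph_join Hs)" "(b, c) \<in> parcs (graph_join Hs)"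
      "(c, d) \<in> parcs (graph_join Hs)" and non: "(a, c) \<notin> parcs (graph_join Hs)"
      "(a, d) \<notin> parcs (graph_join Hs)" "(b, d) \<notin> parcs (graph_join Hs)"
    then obtain A B C D where
      in_Hs: "A \<in> Hs" "a \<in> pverts A" "B \<in> Hs" "b \<in> pverts B" "C \<in> Hs" "c \<in> pverts C"
        "D \<in> Hs" "d \<in> pverts D"
      by (auto simp: graph_join_def)
    \<comment> \<open>Each of the non-edges \<open>ac\<close>, \<open>ad\<close>, \<open>bd\<close>
      forces its two ends into the same operand.\<close>
    have "A = C" "A = D" "B = D"
      using non arc in_Hs by blast+
    with in_Hs arcs non arc show False
      using P4_freeD[OF join.IH, of A a b c d] by blast
  qed
qed

lemma vertex_disjoint_induce_pair:
  "A \<inter> B = {} \<Longrightarrow> vertex_disjoint {pair_induce G A, pair_induce G B}"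
  unfolding vertex_disjoint_def pairwise_def by auto

text \<open>Induction on the number of vertices: a cut of the graph gives a disjoint union of two
  smaller induced subgraphs, a cut of the complement gives a join. The empty graph has to be
  excluded, because it is not a \<open>cograph\<close>.\<close>

lemma cograph_P4_free:
  assumes "pair_graph G" "pverts G \<noteq> {}" "P4_free (pverts G) (parcs G)"
  shows "cograph G"
  using assms
proof (induction "card (pverts G)" arbitrary: G rule: less_induct)
  case less
  from less.prems(1) have fin: "finite (pverts G)" and sub: "parcs G \<subseteq> pverts G \<times> pverts G"
    and sym: "sym (parcs G)" and irr: "irrefl (parcs G)"
    by (auto simp: pair_graph_iff)
  have IH: "cograph (pair_induce G A)" if "A \<subset> pverts G" "A \<noteq> {}" for A
  proof (rule less.hyps)
    have "pverts (pair_induce G A) = A" using that by auto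
    then show "card (pverts (pair_induce G A)) < card (pverts G)" "pverts (pair_induce G A) \<noteq> {}"
      using that psubset_card_mono[OF fin that(1)] by simp_all
    show "pair_graph (pair_induce G A)"
      by (rule pair_graph_pair_induce) (rule less.prems)
    show "P4_free (pverts (pair_induce G A)) (parcs (pair_induce G A))"
      using less.prems(3) by (auto simp: P4_free_def)
  qed
  show ?case
  proof (cases "2 \<le> card (pverts G)")
    case True
    then have "separable (pverts G) (parcs G) \<or> separable (pverts G) (- parcs G)"
      by (rule P4_free_separable[OF fin _ less.prems(3) sym])
    then obtain A B where AB: "A \<noteq> {}" "B \<noteq> {}" "A \<inter> B = {}" "A \<union> B = pverts G"
      and edges: "(\<forall>x\<in>A. \<forall>y\<in>B. (x, y) \<notin> parcs G) \<or> (\<forall>x\<in>A. \<forall>y\<in>B. (x, y) \<in> parcs G)"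
      unfolding separable_def Compl_iff not_not by (elim disjE exE conjE) simp_all
    let ?Hs = "{pair_induce G A, pair_induce G B}"
    have co: "cograph H" if "H \<in> ?Hs" for H
    proof -
      have "A \<subset> pverts G" "B \<subset> pverts G" using AB by blast+
      with that IH AB(1,2) show ?thesis by auto
    qed
    \<comment> \<open>The operands form a set and \<open>graph_join\<close> adds edges only between
      distinct members, so equal parts would contribute no edges between \<open>A\<close> and
      \<open>B\<close>.\<close>
    have neq: "pair_induce G A \<noteq> pair_induce G B"
    proof
      assume "pair_induce G A = pair_induce G B"
      then have "pverts G \<inter> A = pverts G \<inter> B" by (metis pverts_pair_induce)
      with AB show False by blast
    qed
    have ends: "(x \<in> A \<or> x \<in> B) \<and> (y \<in> A \<or> y \<in> B)" if "(x, y) \<in> parcs G" for x y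
      using that AB(4) sub by blast
    from edges show ?thesis
    proof
      assume no: "\<forall>x\<in>A. \<forall>y\<in>B. (x, y) \<notin> parcs G"
      have "parcs G = parcs (graph_union ?Hs)"
      proof (rule set_eqI, clarify)
        fix x y
        show "(x, y) \<in> parcs G \<longleftrightarrow> (x, y) \<in> parcs (graph_union ?Hs)"
          using no ends[of x y] symD[OF sym, of x y] by auto
      qed
      then have "G = graph_union ?Hs"
        using AB by (intro pair_pre_digraph.equality) auto
      with co vertex_disjoint_induce_pair[OF AB(3), of G] show ?thesis
        using cograph.disjoint_union[of ?Hs] by auto
    next
      assume all: "\<forall>x\<in>A. \<forall>y\<in>B. (x, y) \<in> parcs G"
      have join: "(x, y) \<in> parcs (graph_join ?Hs) \<longleftrightarrow>
        (x, y) \<in> parcs G \<and> (x \<in> A \<and> y \<in> A \<or> x \<in> B \<and> y \<in> B) \<or> x \<in> A \<and> y \<in> B \<or> x \<in> B \<and> y \<in> A" for x y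
        using neq neq[symmetric] AB by (auto simp: graph_join_def)
      have "parcs G = parcs (graph_join ?Hs)"
      proof (rule set_eqI, clarify)
        fix x y
        show "(x, y) \<in> parcs G \<longleftrightarrow> (x, y) \<in> parcs (graph_join ?Hs)"
          unfolding join using all ends[of x y] symD[OF sym, of y x] by blast
      qed
      moreover have "pverts (graph_join ?Hs) = pverts G"
        using AB by (auto simp: graph_join_def)
      ultimately have "G = graph_join ?Hs"
        by (intro pair_pre_digraph.equality) auto
      with co vertex_disjoint_induce_pair[OF AB(3), of G] show ?thesis
        using cograph.join[of ?Hs] by auto
    qed
  next
    case False
    moreover have "card (pverts G) \<noteq> 0" using fin less.prems(2) by simp
    ultimately have "card (pverts G) = 1" by linarith
    then obtain v where v: "pverts G = {v}" by (auto simp: card_1_singleton_iff)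
    with sub irr have "parcs G = {}" by (auto simp: irrefl_def)
    with v have "G = \<lparr>pverts = {v}, parcs = {}\<rparr>" by (intro pair_pre_digraph.equality) auto
    then show ?thesis using cograph.single by metis
  qed
qed

section \<open>Disjoint unions of stars\<close>

text \<open>The components are the closed neighbourhoods of the vertices all of whose neighbours are leaves.
  Both ends of an isolated edge qualify, with the same closed neighbourhood.\<close>

lemma disjoint_union_of_starI:
  assumes "pair_graph F"
    and no_path: "\<And>a b c d. (a, b) \<in> parcs F \<Longrightarrow> (b, c) \<in> parcs F \<Longrightarrow> (c, d) \<in> parcs F \<Longrightarrow>
      a \<noteq> c \<Longrightarrow> b \<noteq> d \<Longrightarrow> False"
  shows "disjoint_union_of star F"
proof -
  from assms(1) have fin: "finite (pverts F)" and sub: "parcs F \<subseteq> pverts F \<times> pverts F"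
    and sym: "\<And>x y. (x, y) \<in> parcs F \<Longrightarrow> (y, x) \<in> parcs F" and irr: "\<And>x. (x, x) \<notin> parcs F"
    by (auto simp: pair_graph_iff irrefl_def dest: symD)
  define center where
    "center c \<longleftrightarrow> c \<in> pverts F \<and> (\<forall>x y. (c, x) \<in> parcs F \<longrightarrow> (x, y) \<in> parcs F \<longrightarrow> y = c)" for c
  define N where "N c = insert c {x. (c, x) \<in> parcs F}" for c
  define Hs where "Hs = (\<lambda>c. pair_induce F (N c)) ` {c. center c}"
  have centerD: "y = c" if "center c" "(c, x) \<in> parcs F" "(x, y) \<in> parcs F" for c x y
    using that unfolding center_def by blast
  have N_sub: "N c \<subseteq> pverts F" if "center c" for c
    using that sub unfolding N_def center_def by auto
  have "{c. center c} \<subseteq> pverts F" by (auto simp: center_def)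
  with fin have "finite Hs" unfolding Hs_def by (auto intro: finite_subset)
  moreover have "vertex_disjoint Hs"
  proof -
    have "N c = N c'" if "center c" "center c'" "x \<in> N c" "x \<in> N c'" for c c' x
    \<comment> \<open>Adjacent centres are each other's only neighbour, so both neighbourhoods are
      \<open>{c, c'}\<close>. Otherwise \<open>x\<close> would be a common neighbour, which forces
      \<open>c' = c\<close>.\<close>
    proof (cases "c = c' \<or> (c, c') \<in> parcs F")
      case True
      then show ?thesis
        using centerD[OF that(1)] centerD[OF that(2)] sym unfolding N_def by blast
    next
      case False
      with that have "(c, x) \<in> parcs F" "(c', x) \<in> parcs F" using sym unfolding N_def by auto
      then show ?thesis using centerD[OF that(1)] sym by blast
    qed
    then have "pair_induce F (N c) = pair_induce F (N c')"
      if "center c" "center c'" "x \<in> pverts (pair_induce F (N c))" "x \<in> pverts (pair_induce F (N c'))"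
      for c c' x
      using that by (metis IntD2 pverts_pair_induce)
    then show ?thesis unfolding vertex_disjoint_def pairwise_def Hs_def by blast
  qed
  moreover have "star H" if H_in: "H \<in> Hs" for H
  proof -
    obtain c where c: "center c" and H: "H = pair_induce F (N c)" using H_in unfolding Hs_def by blast
    have verts: "pverts H = N c" using N_sub[OF c] H by auto
    have "(x, y) \<in> parcs H \<longleftrightarrow> (x, y) \<in> {c} \<times> (N c - {c}) \<union> (N c - {c}) \<times> {c}" for x y
      using centerD[OF c] sym irr unfolding H N_def by (auto; blast)
    then have "parcs H = {c} \<times> (pverts H - {c}) \<union> (pverts H - {c}) \<times> {c}"
      unfolding verts by auto
    moreover have "finite (pverts H)" "c \<in> pverts H"
      using fin N_sub[OF c] finite_subset unfolding verts by (auto simp: N_def)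
    ultimately show "star H" unfolding star_def by blast
  qed
  moreover have "F = graph_union Hs"
  proof (rule pair_pre_digraph.equality)
    have cover: "\<exists>c. center c \<and> v \<in> N c" if "v \<in> pverts F" for v
    proof (cases "center v")
      case True
      then show ?thesis unfolding N_def by blast
    next
      case False
      then obtain w x where wx: "(v, w) \<in> parcs F" "(w, x) \<in> parcs F" "x \<noteq> v"
        using \<open>v \<in> pverts F\<close> unfolding center_def by blast
      \<comment> \<open>A neighbour \<open>y\<close> of \<open>w\<close> with a further neighbour
        \<open>z\<close> would start a path \<open>z, y, w\<close> that extends to \<open>v\<close>
        or to \<open>x\<close>, whichever differs from \<open>y\<close>.\<close>
      have "center w"
        unfolding center_def
      proof (intro conjI allI impI)
        show "w \<in> pverts F" using wx sub by blast
        fix y z assume yz: "(w, y) \<in> parcs F" "(y, z) \<in> parcs F"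
        show "z = w"
          using no_path[of z y w v] no_path[of z y w x] wx yz sym[OF yz(1)] sym[OF yz(2)] sym[OF wx(1)]
          by blast
      qed
      then show ?thesis using wx sym unfolding N_def by blast
    qed
    show "pverts F = pverts (graph_union Hs)"
      using cover by (auto simp: Hs_def)
    have "\<exists>c. center c \<and> u \<in> N c \<and> v \<in> N c" if uv: "(u, v) \<in> parcs F" for u v
    proof -
      obtain c where c: "center c" "u \<in> N c" using cover uv sub by blast
      then have "v \<in> N c" using centerD[OF c(1)] uv unfolding N_def by blast
      with c show ?thesis by blast
    qed
    then show "parcs F = parcs (graph_union Hs)"
      by (auto simp: Hs_def)
  qed simp
  ultimately show ?thesis unfolding disjoint_union_of_def by blast
qed

text \<open>The three arcs lie in one star, and the disjoint edges \<open>ab\<close> and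
  \<open>cd\<close> cannot both contain its centre.\<close>

lemma disjoint_union_of_starD:
  assumes "disjoint_union_of star F" "(a, b) \<in> parcs F" "(b, c) \<in> parcs F" "(c, d) \<in> parcs F"
    "a \<noteq> c" "b \<noteq> d" "a \<noteq> d"
  shows False
proof -
  obtain Hs where Hs: "vertex_disjoint Hs" "\<And>H. H \<in> Hs \<Longrightarrow> star H" "F = graph_union Hs"
    using assms(1) unfolding disjoint_union_of_def by blast
  have wf: "x \<in> pverts H \<and> y \<in> pverts H" if "H \<in> Hs" "(x, y) \<in> parcs H" for H x y
    using Hs(2)[OF that(1)] that(2) unfolding star_def by auto
  obtain H K L where *: "H \<in> Hs" "(a, b) \<in> parcs H" "K \<in> Hs" "(b, c) \<in> parcs K"
    "L \<in> Hs" "(c, d) \<in> parcs L"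
    using assms Hs(3) by auto
  then have "H = K" "K = L"
    using vertex_disjointD[OF Hs(1)] wf by metis+
  obtain x where "parcs H = {x} \<times> (pverts H - {x}) \<union> (pverts H - {x}) \<times> {x}"
    using Hs(2)[OF \<open>H \<in> Hs\<close>] unfolding star_def by blast
  then have end_x: "u = x \<and> v \<noteq> x \<or> u \<noteq> x \<and> v = x" if "(u, v) \<in> parcs H" for u v
    using that by auto
  have "(a, b) \<in> parcs H" "(b, c) \<in> parcs H" "(c, d) \<in> parcs H"
    using * \<open>H = K\<close> \<open>K = L\<close> by simp_all
  from this[THEN end_x] assms(5-7) show False by metis
qed

section \<open>Disjoint unions of trees\<close>

text \<open>On a cycle of length at least 3, the predecessor and the successor of a vertex differ.
  This reduces acyclicity to a degree condition on vertex sets, so that later arguments need no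
  walks.\<close>

lemma undirected_cycle_degree:
  assumes "pre_digraph.cycle (with_proj G) p" "3 \<le> length p"
  obtains S where "S \<noteq> {}"
    "\<And>v. v \<in> S \<Longrightarrow> \<exists>x\<in>S. \<exists>y\<in>S. x \<noteq> y \<and> (x, v) \<in> parcs G \<and> (v, y) \<in> parcs G"
proof -
  obtain u where walk: "pre_digraph.awalk (with_proj G) u p u"
    and dist: "distinct (tl (pre_digraph.awalk_verts (with_proj G) u p))"
    using assms unfolding pre_digraph.cycle_def by blast
  have arcs: "set p \<subseteq> parcs G" and cas: "pre_digraph.cas (with_proj G) u p u"
    using walk by (auto simp: pre_digraph.awalk_def)
  let ?n = "length p"
  \<comment> \<open>The vertex list is read once through the tails and once through the heads of the
    arcs. Comparing the two entry by entry gives \<open>shift\<close>.\<close>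
  have verts1: "pre_digraph.awalk_verts (with_proj G) u p = map fst p @ [snd (last p)]"
    using pre_digraph.awalk_verts_conv[of "with_proj G" u p] assms(2) by auto
  have verts2: "pre_digraph.awalk_verts (with_proj G) u p = fst (hd p) # map snd p"
    using pre_digraph.awalk_verts_conv'[OF cas] assms(2) by auto
  have last: "snd (last p) = fst (hd p)"
  proof -
    have "p \<noteq> []" using assms(2) by auto
    have pc: "pcas x q y \<Longrightarrow> q \<noteq> [] \<Longrightarrow> fst (hd q) = x \<and> snd (last q) = y" for x q and y :: 'a
      by (induction q arbitrary: x) auto
    show ?thesis using pc[of u p u] cas \<open>p \<noteq> []\<close> by (simp add: cas_with_proj_eq)
  qed
  have dsnd: "distinct (map snd p)" using dist verts2 by simp
  have shift: "fst (p ! Suc k) = snd (p ! k)" if "Suc k < ?n" for k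
    using arg_cong[OF verts1[symmetric, unfolded verts2], of "\<lambda>xs. xs ! Suc k"] that
    by (simp add: nth_append)
  have wrap: "fst (p ! 0) = snd (p ! (?n - 1))"
    using last assms(2) by (metis hd_conv_nth last_conv_nth list.size(3) not_numeral_le_zero)
  show thesis
  proof (rule that[of "snd ` set p"])
    show "snd ` set p \<noteq> {}" using assms(2) by auto
    fix v assume "v \<in> snd ` set p"
    then obtain k where k: "k < ?n" "v = snd (p ! k)" by (auto simp: in_set_conv_nth)
    \<comment> \<open>Cyclic predecessor and successor of the index \<open>k\<close>. They are
      distinct only because the length is at least 3; for length 2 they coincide.\<close>
    define i where "i = (if k = 0 then ?n - 1 else k - 1)"
    define j where "j = (if Suc k = ?n then 0 else Suc k)"
    have ij: "i < ?n" "j < ?n" "i \<noteq> j" using k(1) assms(2) unfolding i_def j_def by auto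
    have i: "fst (p ! k) = snd (p ! i)"
      using wrap shift[of "k - 1"] k(1) unfolding i_def by auto
    have j: "fst (p ! j) = v"
    proof (cases "Suc k = ?n")
      case True
      then have "k = ?n - 1" by simp
      with True wrap k(2) show ?thesis by (simp add: j_def)
    next
      case False
      with shift[of k] k show ?thesis by (simp add: j_def)
    qed
    have "p ! k = (snd (p ! i), v)" "p ! j = (v, snd (p ! j))"
      using i j k(2) by (simp_all add: prod_eq_iff)
    then have "(snd (p ! i), v) \<in> parcs G" "(v, snd (p ! j)) \<in> parcs G"
      using arcs k(1) ij nth_mem by (metis subsetD)+
    moreover have "snd (p ! i) \<noteq> snd (p ! j)"
      using dsnd ij by (simp add: distinct_conv_nth)
    ultimately show "\<exists>x\<in>snd ` set p. \<exists>y\<in>snd ` set p. x \<noteq> y \<and> (x, v) \<in> parcs G \<and> (v, y) \<in> parcs G"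
      using ij nth_mem by blast
  qed
qed

text \<open>A walk from \<open>v\<close> never leaves the set reachable from \<open>v\<close>, so it
  survives in the induced subgraph. By symmetry any two vertices are then joined through
  \<open>v\<close>.\<close>

lemma connected_pair_induce_reachable:
  assumes "pair_graph F" "v \<in> pverts F"
  shows "Digraph_Component.connected (with_proj (pair_induce F ((parcs F)\<^sup>* `` {v})))"
proof -
  let ?C = "(parcs F)\<^sup>* `` {v}"
  let ?H = "pair_induce F ?C"
  from assms(1) have sub: "parcs F \<subseteq> pverts F \<times> pverts F" and sym: "sym (parcs F)"
    by (auto simp: pair_graph_iff)
  interpret H: pair_graph ?H using assms(1) by (rule pair_graph_pair_induce)
  have reach: "(v, x) \<in> rtrancl_on (pverts ?H) (parcs ?H)" if "(v, x) \<in> (parcs F)\<^sup>*" for x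
    using that
  proof (induction rule: rtrancl_induct)
    case base
    then show ?case using assms(2) by auto
  next
    case (step y z)
    then have "(y, z) \<in> parcs ?H" "z \<in> pverts ?H"
      using sub by (auto intro: rtrancl_into_rtrancl)
    with step.IH show ?case by (rule rtrancl_on_into_rtrancl_on)
  qed
  have symH: "sym (rtrancl_on (pverts ?H) (parcs ?H))"
    by (intro rtrancl_on_sym symI) (rule H.arcs_symmetric)
  have "(x, y) \<in> rtrancl_on (pverts ?H) (parcs ?H)" if "x \<in> pverts ?H" "y \<in> pverts ?H" for x y
    using that reach[of x] reach[of y] symD[OF symH] rtrancl_on_trans by fastforce
  moreover have "pverts ?H \<noteq> {}" using assms(2) by auto
  \<comment> \<open>\<open>connected\<close> refers to the symmetric closure, which changes nothing
    here.\<close>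
  moreover have "parcs (mk_symmetric (with_proj ?H)) = parcs ?H"
    using H.adj_mk_symmetric_eq H.sym_arcs by simp
  ultimately show ?thesis
    unfolding Digraph_Component.connected_def
    by (intro strongly_connectedI) (auto simp: reachable_def)
qed

text \<open>The condition \<open>deg\<close> is 1-degeneracy: every nonempty set has a member with
  at most one neighbour in the set. The vertex set of a cycle would violate it. The trees are the
  connected components \<open>C v\<close>.\<close>

lemma disjoint_union_of_treeI:
  assumes "pair_graph F"
    and deg: "\<And>S. S \<noteq> {} \<Longrightarrow>
      \<exists>v\<in>S. \<forall>x\<in>S. \<forall>y\<in>S. (v, x) \<in> parcs F \<longrightarrow> (v, y) \<in> parcs F \<longrightarrow> x = y"
  shows "disjoint_union_of undirected_tree F"
proof -
  from assms(1) have fin: "finite (pverts F)" and sub: "parcs F \<subseteq> pverts F \<times> pverts F"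
    and sym: "sym (parcs F)"
    by (auto simp: pair_graph_iff)
  define C where "C v = (parcs F)\<^sup>* `` {v}" for v
  define Hs where "Hs = (\<lambda>v. pair_induce F (C v)) ` pverts F"
  have symr: "(x, y) \<in> (parcs F)\<^sup>* \<Longrightarrow> (y, x) \<in> (parcs F)\<^sup>*" for x y
    using sym_rtrancl[OF sym] by (rule symD)
  have C_eq: "C u = C v" if "x \<in> C u" "x \<in> C v" for u v x
  proof -
    have "(u, v) \<in> (parcs F)\<^sup>*" "(v, u) \<in> (parcs F)\<^sup>*"
      using that symr unfolding C_def by (meson Image_singleton_iff rtrancl_trans)+
    then show ?thesis unfolding C_def by (auto intro: rtrancl_trans)
  qed
  have "finite Hs" using fin unfolding Hs_def by simp
  moreover have "vertex_disjoint Hs"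
  proof -
    have "pair_induce F (C u) = pair_induce F (C v)"
      if "x \<in> pverts (pair_induce F (C u))" "x \<in> pverts (pair_induce F (C v))" for u v x
      using C_eq[of x u v] that by simp
    then show ?thesis unfolding vertex_disjoint_def pairwise_def Hs_def by blast
  qed
  moreover have "undirected_tree H" if H_in: "H \<in> Hs" for H
  proof -
    obtain v where v: "v \<in> pverts F" "H = pair_induce F (C v)" using H_in unfolding Hs_def by blast
    have "\<not> (pre_digraph.cycle (with_proj H) p \<and> 3 \<le> length p)" for p
    proof
      assume "pre_digraph.cycle (with_proj H) p \<and> 3 \<le> length p"
      then obtain S where "S \<noteq> {}"
        and S: "\<And>v. v \<in> S \<Longrightarrow> \<exists>x\<in>S. \<exists>y\<in>S. x \<noteq> y \<and> (x, v) \<in> parcs H \<and> (v, y) \<in> parcs H"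
        using undirected_cycle_degree by metis
      obtain w where "w \<in> S" "\<forall>x\<in>S. \<forall>y\<in>S. (w, x) \<in> parcs F \<longrightarrow> (w, y) \<in> parcs F \<longrightarrow> x = y"
        using deg[OF \<open>S \<noteq> {}\<close>] by blast
      with S[of w] show False using v sym by (auto dest: symD)
    qed
    with v show ?thesis
      unfolding undirected_tree_def C_def
      using pair_graph_pair_induce[OF assms(1)] connected_pair_induce_reachable[OF assms(1)] by blast
  qed
  moreover have "F = graph_union Hs"
  proof (rule pair_pre_digraph.equality)
    have "v \<in> C v" for v by (simp add: C_def)
    then show "pverts F = pverts (graph_union Hs)" by (auto simp: Hs_def)
    have "u \<in> C u \<and> v \<in> C u" if "(u, v) \<in> parcs F" for u v
      using that by (auto simp: C_def)
    then show "parcs F = parcs (graph_union Hs)"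
      using sub by (auto simp: Hs_def)
  qed simp
  ultimately show ?thesis unfolding disjoint_union_of_def by blast
qed

text \<open>Shared endpoints put the four arcs into a single tree, where they form a cycle of length
  4.\<close>

lemma disjoint_union_of_tree_no_square:
  assumes "disjoint_union_of undirected_tree F" "distinct [a, b, c, d]"
    "(a, b) \<in> parcs F" "(b, c) \<in> parcs F" "(c, d) \<in> parcs F" "(d, a) \<in> parcs F"
  shows False
proof -
  obtain Hs where Hs: "vertex_disjoint Hs" "\<And>H. H \<in> Hs \<Longrightarrow> undirected_tree H" "F = graph_union Hs"
    using assms(1) unfolding disjoint_union_of_def by blast
  have wf: "x \<in> pverts H \<and> y \<in> pverts H" if "H \<in> Hs" "(x, y) \<in> parcs H" for H x y
    using Hs(2)[OF that(1)] that(2) unfolding undirected_tree_def pair_graph_iff by blast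
  obtain H K L M where *: "H \<in> Hs" "(a, b) \<in> parcs H" "K \<in> Hs" "(b, c) \<in> parcs K"
    "L \<in> Hs" "(c, d) \<in> parcs L" "M \<in> Hs" "(d, a) \<in> parcs M"
    using assms Hs(3) by auto
  then have eq: "H = K" "K = L" "L = M"
    using vertex_disjointD[OF Hs(1)] wf by metis+
  let ?p = "[(a, b), (b, c), (c, d), (d, a)]"
  have "pre_digraph.cycle (with_proj H) ?p"
    unfolding pre_digraph.cycle_def pre_digraph.awalk_def cas_with_proj_eq awalk_verts_with_proj_eq
    using * eq wf assms(2) by (intro exI[of _ a]) auto
  with Hs(2)[OF \<open>H \<in> Hs\<close>] show False
    unfolding undirected_tree_def by fastforce
qed

section \<open>Acyclic and star colourings\<close>

lemma star_coloring_if_P4_free: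
  assumes "pair_graph G" "P4_free (pverts G) (parcs G)" "acyclic_coloring G \<phi>"
  shows "star_coloring G \<phi>"
  unfolding star_coloring_def
proof (intro conjI allI impI)
  show proper: "proper_coloring G \<phi>" using assms(3) by (simp add: acyclic_coloring_def)
  fix i j :: nat assume "0 < i" "0 < j" "i \<noteq> j"
  let ?F = "pair_induce G (color_class G \<phi> i \<union> color_class G \<phi> j)"
  have forest: "disjoint_union_of undirected_tree ?F"
    using assms(3) \<open>0 < i\<close> \<open>0 < j\<close> \<open>i \<noteq> j\<close> by (simp add: acyclic_coloring_def)
  from assms(1) have sub: "parcs G \<subseteq> pverts G \<times> pverts G" and sym: "sym (parcs G)"
    by (auto simp: pair_graph_iff)
  show "disjoint_union_of star ?F"
  proof (rule disjoint_union_of_starI)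
    show "pair_graph ?F" using assms(1) by (rule pair_graph_pair_induce)
    fix a b c d
    assume e: "(a, b) \<in> parcs ?F" "(b, c) \<in> parcs ?F" "(c, d) \<in> parcs ?F" and "a \<noteq> c" "b \<noteq> d"
    have neq: "\<phi> x \<noteq> \<phi> y" if "(x, y) \<in> parcs G" for x y
      using that proper unfolding proper_coloring_def by blast
    have col: "\<phi> x = i \<or> \<phi> x = j" if "x \<in> {a, b, c, d}" for x
      using that e by (auto simp: color_class_def)
    have "\<phi> a \<noteq> \<phi> b" "\<phi> b \<noteq> \<phi> c" "\<phi> c \<noteq> \<phi> d" using neq e by auto
    \<comment> \<open>Only the colours \<open>i\<close> and \<open>j\<close> are available, so they
      alternate along the path.\<close>
    with col have same: "\<phi> a = \<phi> c" "\<phi> b = \<phi> d" by (metis insertCI)+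
    with neq have non: "(a, c) \<notin> parcs G" "(b, d) \<notin> parcs G" by metis+
    have dist: "distinct [a, b, c, d]"
      using \<open>a \<noteq> c\<close> \<open>b \<noteq> d\<close> \<open>\<phi> a \<noteq> \<phi> b\<close> \<open>\<phi> b \<noteq> \<phi> c\<close> \<open>\<phi> c \<noteq> \<phi> d\<close> same by auto
    show False
    proof (cases "(a, d) \<in> parcs G")
      case True
      then have "(d, a) \<in> parcs ?F" using e sym by (auto dest: symD)
      then show False using disjoint_union_of_tree_no_square[OF forest dist] e by blast
    next
      case False
      then show False using P4_freeD[OF assms(2) _ _ _ _ dist] e non sub by auto
    qed
  qed
qed

text \<open>Colour classes are independent, so every edge between the two classes contains
  \<open>x\<close>: the subgraph is a star plus isolated vertices.\<close>

lemma disjoint_union_of_tree_singleton_color: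
  assumes "pair_graph G" "proper_coloring G \<phi>" "color_class G \<phi> j \<subseteq> {x}"
  shows "disjoint_union_of undirected_tree (pair_induce G (color_class G \<phi> i \<union> color_class G \<phi> j))"
    (is "disjoint_union_of _ ?F")
proof (rule disjoint_union_of_treeI)
  show "pair_graph ?F" using assms(1) by (rule pair_graph_pair_induce)
  fix S :: "'a set" assume "S \<noteq> {}"
  have edge: "(u = x \<or> v = x) \<and> u \<noteq> v" if "(u, v) \<in> parcs ?F" for u v
  proof -
    have "\<phi> u \<noteq> \<phi> v" using that assms(2) by (simp add: proper_coloring_def)
    with that have "u \<in> color_class G \<phi> j \<or> v \<in> color_class G \<phi> j"
      by (auto simp: color_class_def)
    with assms(3) \<open>\<phi> u \<noteq> \<phi> v\<close> show ?thesis by auto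
  qed
  \<comment> \<open>Any member other than \<open>x\<close> has at most \<open>x\<close> as a
    neighbour. If \<open>S\<close> is \<open>{x}\<close>, there is only one candidate neighbour
    anyway.\<close>
  obtain v where "v \<in> S" "v = x \<longrightarrow> S = {x}" using \<open>S \<noteq> {}\<close> by blast
  then show "\<exists>v\<in>S. \<forall>y\<in>S. \<forall>z\<in>S. (v, y) \<in> parcs ?F \<longrightarrow> (v, z) \<in> parcs ?F \<longrightarrow> y = z"
    using edge by blast
qed

lemma P4_free_if_acyclic_imp_star:
  assumes "pair_graph G" "\<And>\<phi>. acyclic_coloring G \<phi> \<Longrightarrow> star_coloring G \<phi>"
  shows "P4_free (pverts G) (parcs G)"
proof (rule ccontr)
  assume "\<not> ?thesis"
  then obtain a b c d where P4: "distinct [a, b, c, d]"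
    "(a, b) \<in> parcs G" "(b, c) \<in> parcs G" "(c, d) \<in> parcs G"
    "(a, c) \<notin> parcs G" "(a, d) \<notin> parcs G" "(b, d) \<notin> parcs G"
    unfolding P4_free_def by blast
  from assms(1) have fin: "finite (pverts G)" and sub: "parcs G \<subseteq> pverts G \<times> pverts G"
    and sym: "\<And>x y. (x, y) \<in> parcs G \<Longrightarrow> (y, x) \<in> parcs G" and irr: "\<And>x. (x, x) \<notin> parcs G"
    by (auto simp: pair_graph_iff irrefl_def dest: symD)
  obtain f :: "'a \<Rightarrow> nat" where f: "inj_on f (pverts G)"
    using finite_imp_inj_to_nat_seg[OF fin] by blast
  \<comment> \<open>The offset 3 keeps the remaining vertices off the colours 1 and 2, and
    injectivity of \<open>f\<close> separates them from each other.\<close>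
  define \<phi> where "\<phi> v = (if v = a \<or> v = c then 1 else if v = b \<or> v = d then 2 else f v + 3)" for v
  have proper: "proper_coloring G \<phi>"
    unfolding proper_coloring_def
  proof (intro conjI ballI allI impI)
    show "0 < \<phi> v" for v by (simp add: \<phi>_def)
    fix x y assume e: "(x, y) \<in> parcs G"
    then have "x \<in> pverts G" "y \<in> pverts G" "x \<noteq> y" using sub irr by auto
    then have "f x \<noteq> f y" using f by (auto simp: inj_on_def)
    moreover have "(c, a) \<notin> parcs G" "(d, b) \<notin> parcs G" using sym P4 by blast+
    ultimately show "\<phi> x \<noteq> \<phi> y"
      using e P4 \<open>x \<noteq> y\<close> unfolding \<phi>_def by (auto split: if_splits)
  qed
  have small: "\<exists>x. color_class G \<phi> k \<subseteq> {x}" if "k \<noteq> 1" "k \<noteq> 2" for k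
  proof -
    have "u = v" if "u \<in> color_class G \<phi> k" "v \<in> color_class G \<phi> k" for u v
      using that \<open>k \<noteq> 1\<close> \<open>k \<noteq> 2\<close> f
      by (auto simp: color_class_def \<phi>_def inj_on_def split: if_splits)
    then show ?thesis by blast
  qed
  let ?F = "\<lambda>i j. pair_induce G (color_class G \<phi> i \<union> color_class G \<phi> j)"
  have comm: "?F i j = ?F j i" for i j by (simp add: Un_commute)
  have "color_class G \<phi> 1 \<union> color_class G \<phi> 2 = {a, b, c, d}"
    using P4 sub by (auto simp: color_class_def \<phi>_def split: if_splits)
  then have F12: "?F 1 2 = pair_induce G {a, b, c, d}" by simp
  have path: "disjoint_union_of undirected_tree (?F 1 2)"
    unfolding F12
  proof (rule disjoint_union_of_treeI)
    show "pair_graph (pair_induce G {a, b, c, d})" using assms(1) by (rule pair_graph_pair_induce)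
    fix S :: "'a set" assume "S \<noteq> {}"
    \<comment> \<open>The first vertex of the path that lies in \<open>S\<close> can have only its
      successor as a neighbour in \<open>S\<close>. If \<open>S\<close> meets the path at most in
      \<open>d\<close>, any member will do.\<close>
    then obtain v where v: "v \<in> S" "a \<in> S \<longrightarrow> v = a" "a \<notin> S \<and> b \<in> S \<longrightarrow> v = b"
      "a \<notin> S \<and> b \<notin> S \<and> c \<in> S \<longrightarrow> v = c"
      by blast
    have "(d, a) \<notin> parcs G" using sym P4 by blast
    then show "\<exists>v\<in>S. \<forall>x\<in>S. \<forall>y\<in>S. (v, x) \<in> parcs (pair_induce G {a, b, c, d}) \<longrightarrow>
      (v, y) \<in> parcs (pair_induce G {a, b, c, d}) \<longrightarrow> x = y"
      using v P4 irr by (intro bexI[of _ v]) auto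
  qed
  have "disjoint_union_of undirected_tree (?F i j)" if "i \<noteq> j" for i j
  proof (cases "{i, j} = {1, 2}")
    case True
    then show ?thesis using path comm by (metis doubleton_eq_iff)
  next
    case False
    \<comment> \<open>One of the two colours is neither 1 nor 2, so by \<open>small\<close> its
      class has at most one vertex.\<close>
    with that consider "j \<noteq> 1" "j \<noteq> 2" | "i \<noteq> 1" "i \<noteq> 2" by blast
    then show ?thesis
    proof cases
      case 1
      then show ?thesis
        using small disjoint_union_of_tree_singleton_color[OF assms(1) proper] by blast
    next
      case 2
      then show ?thesis
        unfolding comm[of i j]
        using small disjoint_union_of_tree_singleton_color[OF assms(1) proper] by blast
    qed
  qed
  with proper have "acyclic_coloring G \<phi>" by (simp add: acyclic_coloring_def)
  then have "star_coloring G \<phi>" by (rule assms(2))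
  then have "disjoint_union_of star (?F 1 2)" by (simp add: star_coloring_def)
  then show False
    unfolding F12 by (rule disjoint_union_of_starD[of _ a b c d]) (use P4 in auto)
qed

theorem theorem2:
  fixes G :: "'a pair_pre_digraph"
  assumes "pair_graph G" and "pverts G \<noteq> {}"
  shows "cograph G \<longleftrightarrow> (\<forall>\<phi>. acyclic_coloring G \<phi> \<longrightarrow> star_coloring G \<phi>)"
  using P4_free_cograph star_coloring_if_P4_free[OF assms(1)] P4_free_if_acyclic_imp_star[OF assms(1)]
    cograph_P4_free[OF assms] by blast

end
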